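(* Let $\mathcal C$ be a balanced factorization category. For every object $X$ of $\mathcal C$ the two underlying categories of $X$ are related by duality: $\overline X'\cong\overline X^{\,\mathrm{op}}$ (isomorphism of categories).
   Context: A balanced factorization category is a finitely complete category $\mathcal C$ with two (orthogonal) factorization systems $(\mathcal E,\mathcal M)$ and $(\mathcal E',\mathcal M')$ such that $\mathcal M/1=\mathcal M'/1$ (an object $S$ has $S\to 1$ in $\mathcal M$ iff in $\mathcal M'$), and such that the pullback of a map in $\mathcal E$ along a map in $\mathcal M'$ is in $\mathcal E$, and the pullback of a map in $\mathcal E'$ along a map in $\mathcal M$ is in $\mathcal E'$. Factorizations are chosen. A point $x:1\to X$ factors as $1\xrightarrow{e_x}X/x\xrightarrow{\downarrow x}X$ with $e_x\in\mathcal E$, $\downarrow x\in\mathcal M$ (slice), and as $1\xrightarrow{i_x}x\backslash X\xrightarrow{\uparrow x}X$ with $i_x\in\mathcal E'$, $\uparrow x\in\mathcal M'$ (coslice). The (left) underlying category $\overline X$ has the points $1\to X$ as objects and $\overline X(x,y):=(\mathcal C/X)(X/x,X/y)$, with composition of maps over $X$. The right underlying category $\overline X'$ has the points $1\to X$ as objects and $\overline X'(x,y):=(\mathcal C/X)(x\backslash X,y\backslash X)$, with composition of maps over $X$. (Here $X/x$ and $x\backslash X$ are regarded as objects of $\mathcal C/X$ via $\downarrow x$ and $\uparrow x$.) *)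

theory Defs
  imports Main
begin

record ('o, 'a) cat =
  Obj :: "'o set"
  Arr :: "'a set"
  Dom :: "'a \<Rightarrow> 'o"
  Cod :: "'a \<Rightarrow> 'o"
  Ident :: "'o \<Rightarrow> 'a"
  Comp :: "'a \<Rightarrow> 'a \<Rightarrow> 'a"  \<comment> \<open>\<open>Comp C g f\<close> is \<open>g\<close> after \<open>f\<close>\<close>

definition Hom :: "('o, 'a) cat \<Rightarrow> 'o \<Rightarrow> 'o \<Rightarrow> 'a set" where
  "Hom C a b = {f \<in> Arr C. Dom C f = a \<and> Cod C f = b}"

locale category =
  fixes C :: "('o, 'a) cat"
  assumes dom_obj: "f \<in> Arr C \<Longrightarrow> Dom C f \<in> Obj C"
    and cod_obj: "f \<in> Arr C \<Longrightarrow> Cod C f \<in> Obj C"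
    and ident_hom: "a \<in> Obj C \<Longrightarrow> Ident C a \<in> Hom C a a"
    and comp_hom: "\<lbrakk>f \<in> Hom C a b; g \<in> Hom C b c\<rbrakk> \<Longrightarrow> Comp C g f \<in> Hom C a c"
    and comp_ident_right: "f \<in> Hom C a b \<Longrightarrow> Comp C f (Ident C a) = f"
    and comp_ident_left: "f \<in> Hom C a b \<Longrightarrow> Comp C (Ident C b) f = f"
    and comp_assoc: "\<lbrakk>f \<in> Hom C a b; g \<in> Hom C b c; h \<in> Hom C c d\<rbrakk>
      \<Longrightarrow> Comp C h (Comp C g f) = Comp C (Comp C h g) f"

locale cat_functor = dom_cat: category C + cod_cat: category D
  for C :: "('o, 'a) cat" and D :: "('p, 'b) cat" +
  fixes Fo :: "'o \<Rightarrow> 'p" and Fa :: "'a \<Rightarrow> 'b"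
  assumes map_obj: "a \<in> Obj C \<Longrightarrow> Fo a \<in> Obj D"
    and map_hom: "f \<in> Hom C a b \<Longrightarrow> Fa f \<in> Hom D (Fo a) (Fo b)"
    and map_ident: "a \<in> Obj C \<Longrightarrow> Fa (Ident C a) = Ident D (Fo a)"
    and map_comp: "\<lbrakk>f \<in> Hom C a b; g \<in> Hom C b c\<rbrakk>
      \<Longrightarrow> Fa (Comp C g f) = Comp D (Fa g) (Fa f)"

definition isomorphic_categories :: "('o, 'a) cat \<Rightarrow> ('p, 'b) cat \<Rightarrow> bool" where
  "isomorphic_categories C D \<longleftrightarrow>
    (\<exists>Fo Fa Go Ga. cat_functor C D Fo Fa \<and> cat_functor D C Go Ga \<and>
      (\<forall>a \<in> Obj C. Go (Fo a) = a) \<and> (\<forall>f \<in> Arr C. Ga (Fa f) = f) \<and>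
      (\<forall>b \<in> Obj D. Fo (Go b) = b) \<and> (\<forall>g \<in> Arr D. Fa (Ga g) = g))"

definition op_cat :: "('o, 'a) cat \<Rightarrow> ('o, 'a) cat" where
  "op_cat C = \<lparr>Obj = Obj C, Arr = Arr C, Dom = Cod C, Cod = Dom C,
    Ident = Ident C, Comp = (\<lambda>g f. Comp C f g)\<rparr>"

definition terminal :: "('o, 'a) cat \<Rightarrow> 'o \<Rightarrow> bool" where
  "terminal C t \<longleftrightarrow> t \<in> Obj C \<and> (\<forall>a \<in> Obj C. \<exists>!f. f \<in> Hom C a t)"

definition cone ::
  "('i, 'u) cat \<Rightarrow> ('o, 'a) cat \<Rightarrow> ('i \<Rightarrow> 'o) \<Rightarrow> ('u \<Rightarrow> 'a) \<Rightarrow> 'o \<Rightarrow> ('i \<Rightarrow> 'a) \<Rightarrow> bool" where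
  "cone J C Do Da c p \<longleftrightarrow> c \<in> Obj C \<and> (\<forall>j \<in> Obj J. p j \<in> Hom C c (Do j)) \<and>
    (\<forall>u \<in> Arr J. Comp C (Da u) (p (Dom J u)) = p (Cod J u))"

definition limit_cone ::
  "('i, 'u) cat \<Rightarrow> ('o, 'a) cat \<Rightarrow> ('i \<Rightarrow> 'o) \<Rightarrow> ('u \<Rightarrow> 'a) \<Rightarrow> 'o \<Rightarrow> ('i \<Rightarrow> 'a) \<Rightarrow> bool" where
  "limit_cone J C Do Da c p \<longleftrightarrow> cone J C Do Da c p \<and>
    (\<forall>c' p'. cone J C Do Da c' p' \<longrightarrow>
      (\<exists>!h. h \<in> Hom C c' c \<and> (\<forall>j \<in> Obj J. Comp C (p j) h = p' j)))"

text \<open>Every finite category is isomorphic to one whose objects and arrows are natural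
  numbers, so it is enough to take diagrams of these shapes.\<close>

definition finitely_complete :: "('o, 'a) cat \<Rightarrow> bool" where
  "finitely_complete C \<longleftrightarrow>
    (\<forall>(J :: (nat, nat) cat) Do Da.
      finite (Obj J) \<and> finite (Arr J) \<and> cat_functor J C Do Da \<longrightarrow>
      (\<exists>c p. limit_cone J C Do Da c p))"

text \<open>\<open>p\<close> is the pullback of \<open>g\<close> along \<open>f\<close>, and \<open>q\<close> the pullback of \<open>f\<close> along \<open>g\<close>.\<close>

definition is_pullback :: "('o, 'a) cat \<Rightarrow> 'a \<Rightarrow> 'a \<Rightarrow> 'a \<Rightarrow> 'a \<Rightarrow> bool" where
  "is_pullback C f g p q \<longleftrightarrow>
    f \<in> Arr C \<and> g \<in> Arr C \<and> p \<in> Arr C \<and> q \<in> Arr C \<and>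
    Cod C f = Cod C g \<and> Dom C p = Dom C q \<and> Cod C p = Dom C f \<and> Cod C q = Dom C g \<and>
    Comp C f p = Comp C g q \<and>
    (\<forall>a u v. u \<in> Hom C a (Dom C f) \<and> v \<in> Hom C a (Dom C g) \<and> Comp C f u = Comp C g v \<longrightarrow>
      (\<exists>!h. h \<in> Hom C a (Dom C p) \<and> Comp C p h = u \<and> Comp C q h = v))"

definition orthogonal :: "('o, 'a) cat \<Rightarrow> 'a \<Rightarrow> 'a \<Rightarrow> bool" where
  "orthogonal C e m \<longleftrightarrow>
    (\<forall>u v. u \<in> Hom C (Dom C e) (Dom C m) \<and> v \<in> Hom C (Cod C e) (Cod C m) \<and>
        Comp C m u = Comp C v e \<longrightarrow>
      (\<exists>!d. d \<in> Hom C (Cod C e) (Dom C m) \<and> Comp C d e = u \<and> Comp C m d = v))"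

text \<open>A pair of classes \<open>(\<E>, \<M>)\<close> with a choice of factorization
  \<open>f = right_fac f \<circ> left_fac f\<close> of each arrow \<open>f\<close>.\<close>

record 'a fact_sys =
  left_class :: "'a set"
  right_class :: "'a set"
  left_fac :: "'a \<Rightarrow> 'a"
  right_fac :: "'a \<Rightarrow> 'a"

locale factorization_system = category C
  for C :: "('o, 'a) cat" +
  fixes F :: "'a fact_sys"
  assumes left_class_eq:
      "left_class F = {e \<in> Arr C. \<forall>m \<in> right_class F. orthogonal C e m}"
    and right_class_eq:
      "right_class F = {m \<in> Arr C. \<forall>e \<in> left_class F. orthogonal C e m}"
    and left_fac: "f \<in> Arr C \<Longrightarrow> left_fac F f \<in> left_class F"
    and right_fac: "f \<in> Arr C \<Longrightarrow> right_fac F f \<in> right_class F"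
    and fac_composable: "f \<in> Arr C \<Longrightarrow> Cod C (left_fac F f) = Dom C (right_fac F f)"
    and fac_comp: "f \<in> Arr C \<Longrightarrow> Comp C (right_fac F f) (left_fac F f) = f"

locale balanced_factorization_category =
  fs: factorization_system C F + fs': factorization_system C F'
  for C :: "('o, 'a) cat" and one :: 'o and F F' :: "'a fact_sys" +
  assumes finitely_complete: "finitely_complete C"
    and terminal_one: "terminal C one"
    and right_classes_over_one:
      "\<lbrakk>S \<in> Obj C; t \<in> Hom C S one\<rbrakk> \<Longrightarrow> t \<in> right_class F \<longleftrightarrow> t \<in> right_class F'"
    and pullback_left:
      "\<lbrakk>e \<in> left_class F; m \<in> right_class F'; is_pullback C e m p q\<rbrakk> \<Longrightarrow> q \<in> left_class F"
    and pullback_left':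
      "\<lbrakk>e \<in> left_class F'; m \<in> right_class F; is_pullback C e m p q\<rbrakk> \<Longrightarrow> q \<in> left_class F'"

text \<open>In the slice over \<open>X\<close>, an arrow \<open>h\<close> from \<open>f\<close> to \<open>g\<close> is recorded as \<open>(f, h, g)\<close>.\<close>

definition slice_cat :: "('o, 'a) cat \<Rightarrow> 'o \<Rightarrow> ('a, 'a \<times> 'a \<times> 'a) cat" where
  "slice_cat C X = \<lparr>
    Obj = {f \<in> Arr C. Cod C f = X},
    Arr = {(f, h, g). f \<in> Arr C \<and> Cod C f = X \<and> g \<in> Arr C \<and> Cod C g = X \<and>
             h \<in> Hom C (Dom C f) (Dom C g) \<and> Comp C g h = f},
    Dom = (\<lambda>(f, h, g). f),
    Cod = (\<lambda>(f, h, g). g),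
    Ident = (\<lambda>f. (f, Ident C (Dom C f), f)),
    Comp = (\<lambda>(_, k, g) (f, h, _). (f, Comp C k h, g))\<rparr>"

text \<open>The category with object set \<open>S\<close> and hom-sets \<open>D(\<phi> x, \<phi> y)\<close>, with the composition
  of \<open>D\<close>. Arrows carry their source and target in \<open>S\<close>, since \<open>\<phi>\<close> need not be injective.\<close>

definition induced_cat :: "'s set \<Rightarrow> ('s \<Rightarrow> 'o) \<Rightarrow> ('o, 'a) cat \<Rightarrow> ('s, 's \<times> 'a \<times> 's) cat" where
  "induced_cat S \<phi> D = \<lparr>
    Obj = S,
    Arr = {(x, h, y). x \<in> S \<and> y \<in> S \<and> h \<in> Hom D (\<phi> x) (\<phi> y)},
    Dom = (\<lambda>(x, h, y). x),
    Cod = (\<lambda>(x, h, y). y),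
    Ident = (\<lambda>x. (x, Ident D (\<phi> x), x)),
    Comp = (\<lambda>(_, k, z) (x, h, _). (x, Comp D k h, z))\<rparr>"

text \<open>For a point \<open>x : 1 \<rightarrow> X\<close>, the arrow \<open>right_fac F x\<close> is \<open>\<down>x : X/x \<rightarrow> X\<close> if
  \<open>F = (\<E>, \<M>)\<close>, and it is \<open>\<up>x : x\X \<rightarrow> X\<close> if \<open>F = (\<E>', \<M>')\<close>. So this gives the left
  underlying category of \<open>X\<close> in the first case and the right one in the second.\<close>

definition underlying_cat ::
  "('o, 'a) cat \<Rightarrow> 'o \<Rightarrow> 'a fact_sys \<Rightarrow> 'o \<Rightarrow> ('a, 'a \<times> ('a \<times> 'a \<times> 'a) \<times> 'a) cat" where
  "underlying_cat C one F X = induced_cat (Hom C one X) (right_fac F) (slice_cat C X)"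

end

theory Submission imports Defs begin

text \<open>Let \<open>P\<close> be the pullback of \<open>\<up>x\<close> and \<open>\<down>y\<close>. Call \<open>h : X/x \<rightarrow> X/y\<close> and \<open>k : y\X \<rightarrow> x\X\<close>,
  both over \<open>X\<close>, dual if every map from \<open>P\<close> to an object of \<open>\<M>/1 = \<M>'/1\<close> identifies the points
  \<open>(i\<^sub>x, h e\<^sub>x)\<close> and \<open>(k i\<^sub>y, e\<^sub>y)\<close> of \<open>P\<close>. Duality evidently respects identities and composition.
  The pullback \<open>t : T \<rightarrow> P\<close> of \<open>e\<^sub>y\<close> along \<open>P \<rightarrow> X/y\<close> lies in \<open>\<E>\<close>, because \<open>P \<rightarrow> X/y\<close> lies in
  \<open>\<M>'\<close>, and \<open>T\<close> lies in \<open>\<M>'/1 = \<M>/1\<close>. So \<open>t\<close> has a retraction which is the reflection of \<open>P\<close> in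
  \<open>\<M>/1\<close>, and as the points of \<open>T\<close> are the points of \<open>x\X\<close> over \<open>y\<close>, each \<open>h\<close> has exactly one
  dual \<open>k\<close>. Exchanging the two factorization systems, each \<open>k\<close> is dual to exactly one \<open>h\<close>.\<close>

section \<open>Categories\<close>

lemma HomI: "\<lbrakk>f \<in> Arr C; Dom C f = a; Cod C f = b\<rbrakk> \<Longrightarrow> f \<in> Hom C a b"
  by (simp add: Hom_def)

lemma HomD:
  assumes "f \<in> Hom C a b"
  shows "f \<in> Arr C" "Dom C f = a" "Cod C f = b"
  using assms by (simp_all add: Hom_def)

context category
begin

lemma hom_dom_obj: "f \<in> Hom C a b \<Longrightarrow> a \<in> Obj C"
  and hom_cod_obj: "f \<in> Hom C a b \<Longrightarrow> b \<in> Obj C"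
  using dom_obj cod_obj by (auto simp: Hom_def)

lemma comp_arr:
  assumes "f \<in> Arr C" "g \<in> Arr C" "Cod C f = Dom C g"
  shows "Comp C g f \<in> Arr C" "Dom C (Comp C g f) = Dom C f" "Cod C (Comp C g f) = Cod C g"
  using comp_hom[of f "Dom C f" "Dom C g" g "Cod C g"] assms by (auto simp: Hom_def)

lemma category_op_cat: "category (op_cat C)"
proof -
  have hom: "Hom (op_cat C) a b = Hom C b a" for a b
    by (auto simp: Hom_def op_cat_def)
  show ?thesis
    by unfold_locales
      (unfold hom, auto simp: op_cat_def dom_obj cod_obj ident_hom comp_hom comp_ident_left
        comp_ident_right comp_assoc)
qed

lemma category_slice_cat: "category (slice_cat C X)"
proof -
  have hom: "\<phi> \<in> Hom (slice_cat C X) f g \<longleftrightarrow> (\<exists>h. \<phi> = (f, h, g) \<and> f \<in> Arr C \<and> Cod C f = X \<and>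
      g \<in> Arr C \<and> Cod C g = X \<and> h \<in> Hom C (Dom C f) (Dom C g) \<and> Comp C g h = f)" for \<phi> f g
    by (auto simp: Hom_def slice_cat_def)
  have comp: "Comp C g (Comp C k h) = f"
    if "h \<in> Hom C a b" "k \<in> Hom C b (Dom C g)" "Comp C g k = f'" "Comp C f' h = f" "g \<in> Arr C"
    for a b f f' g h k
    using comp_assoc[of h a b k "Dom C g" g "Cod C g"] that by (auto simp: Hom_def)
  show ?thesis
  proof
    show "Dom (slice_cat C X) \<phi> \<in> Obj (slice_cat C X)"
      "Cod (slice_cat C X) \<phi> \<in> Obj (slice_cat C X)" if "\<phi> \<in> Arr (slice_cat C X)" for \<phi>
      using that by (auto simp: slice_cat_def)
    show "Ident (slice_cat C X) f \<in> Hom (slice_cat C X) f f" if "f \<in> Obj (slice_cat C X)" for f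
      unfolding hom using that dom_obj ident_hom comp_ident_right[of f]
      by (auto simp: slice_cat_def Hom_def)
    show "Comp (slice_cat C X) \<psi> \<phi> \<in> Hom (slice_cat C X) f f''"
      if "\<phi> \<in> Hom (slice_cat C X) f f'" "\<psi> \<in> Hom (slice_cat C X) f' f''" for \<phi> \<psi> f f' f''
      using that unfolding hom by (auto simp: slice_cat_def intro: comp_hom comp)
  qed (auto simp: hom, auto simp: slice_cat_def comp_ident_left comp_ident_right comp_assoc)
qed

lemma category_induced_cat:
  assumes "\<And>s. s \<in> S \<Longrightarrow> \<phi> s \<in> Obj C"
  shows "category (induced_cat S \<phi> C)"
proof -
  have hom: "f \<in> Hom (induced_cat S \<phi> C) x y \<longleftrightarrow>
      (\<exists>h. f = (x, h, y) \<and> x \<in> S \<and> y \<in> S \<and> h \<in> Hom C (\<phi> x) (\<phi> y))" for f x y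
    by (auto simp: Hom_def induced_cat_def)
  show ?thesis
  proof
    show "Comp (induced_cat S \<phi> C) g f \<in> Hom (induced_cat S \<phi> C) x z"
      if "f \<in> Hom (induced_cat S \<phi> C) x y" "g \<in> Hom (induced_cat S \<phi> C) y z" for f g x y z
      using that unfolding hom by (auto simp: induced_cat_def intro: comp_hom)
  qed (auto simp: hom, auto simp: induced_cat_def assms ident_hom comp_ident_left
      comp_ident_right comp_assoc)
qed

end

text \<open>The two uniqueness hypotheses make \<open>R\<close> the graph of a bijection between
  each pair of hom-sets. Since the partner of an arrow is unique, compatibility of \<open>R\<close>
  with identities and composition becomes functoriality in both directions. This allows duality to
  be handled as a symmetric relation, without a formula for the dual of a map.\<close>

lemma isomorphic_categories_if_bijective_relation:
  assumes C: "category C" and D: "category D" and obj: "Obj D = Obj C"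
    and ex1_right: "\<And>a b f. f \<in> Hom C a b \<Longrightarrow> \<exists>!g. g \<in> Hom D a b \<and> R f g"
    and ex1_left: "\<And>a b g. g \<in> Hom D a b \<Longrightarrow> \<exists>!f. f \<in> Hom C a b \<and> R f g"
    and ident: "\<And>a. a \<in> Obj C \<Longrightarrow> R (Ident C a) (Ident D a)"
    and comp: "\<And>a b c f f' g g'. \<lbrakk>f \<in> Hom C a b; f' \<in> Hom C b c; g \<in> Hom D a b; g' \<in> Hom D b c;
      R f g; R f' g'\<rbrakk> \<Longrightarrow> R (Comp C f' f) (Comp D g' g)"
  shows "isomorphic_categories C D"
proof -
  define Fa where "Fa f = (THE g. g \<in> Hom D (Dom C f) (Cod C f) \<and> R f g)" for f
  define Ga where "Ga g = (THE f. f \<in> Hom C (Dom D g) (Cod D g) \<and> R f g)" for g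
  interpret C: category C by (rule C)
  interpret D: category D by (rule D)
  have Fa: "Fa f \<in> Hom D a b \<and> R f (Fa f)" if "f \<in> Hom C a b" for f a b
    using theI'[OF ex1_right[OF that]] HomD[OF that] by (simp add: Fa_def)
  have Ga: "Ga g \<in> Hom C a b \<and> R (Ga g) g" if "g \<in> Hom D a b" for g a b
    using theI'[OF ex1_left[OF that]] HomD[OF that] by (simp add: Ga_def)
  have Fa_eq: "Fa f = g" if "f \<in> Hom C a b" "g \<in> Hom D a b" "R f g" for f g a b
    using ex1_right[OF that(1)] Fa[OF that(1)] that by blast
  have Ga_eq: "Ga g = f" if "f \<in> Hom C a b" "g \<in> Hom D a b" "R f g" for f g a b
    using ex1_left[OF that(2)] Ga[OF that(2)] that by blast
  have "cat_functor C D (\<lambda>a. a) Fa"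
  proof
    show "Fa (Comp C f' f) = Comp D (Fa f') (Fa f)" if "f \<in> Hom C a b" "f' \<in> Hom C b c"
      for f f' a b c
      using Fa[OF that(1)] Fa[OF that(2)] comp that by (blast intro: Fa_eq C.comp_hom D.comp_hom)
    show "Fa (Ident C a) = Ident D a" if "a \<in> Obj C" for a
      using Fa_eq[OF C.ident_hom D.ident_hom ident] that obj by simp
  qed (simp_all add: obj Fa)
  moreover have "cat_functor D C (\<lambda>a. a) Ga"
  proof
    show "Ga (Comp D g' g) = Comp C (Ga g') (Ga g)" if "g \<in> Hom D a b" "g' \<in> Hom D b c"
      for g g' a b c
      using Ga[OF that(1)] Ga[OF that(2)] comp that by (blast intro: Ga_eq C.comp_hom D.comp_hom)
    show "Ga (Ident D a) = Ident C a" if "a \<in> Obj D" for a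
      using Ga_eq[OF C.ident_hom D.ident_hom ident] that obj by simp
  qed (simp_all add: obj Ga)
  moreover have "Ga (Fa f) = f" if "f \<in> Arr C" for f
    using Fa[OF HomI[OF that refl refl]] that by (blast intro: Ga_eq HomI)
  moreover have "Fa (Ga g) = g" if "g \<in> Arr D" for g
    using Ga[OF HomI[OF that refl refl]] that by (blast intro: Fa_eq HomI)
  ultimately show ?thesis
    unfolding isomorphic_categories_def
    by (intro exI[of _ "\<lambda>a. a"] exI[of _ Fa] exI[of _ Ga]) simp
qed

section \<open>Pullbacks and orthogonality\<close>

lemma is_pullback_sym: "is_pullback C f g p q \<Longrightarrow> is_pullback C g f q p"
  unfolding is_pullback_def by (intro conjI allI impI; (elim conjE)?; metis)

lemma is_pullback_lift:
  assumes "is_pullback C f g p q"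
    and "u \<in> Hom C a (Dom C f)" "v \<in> Hom C a (Dom C g)" "Comp C f u = Comp C g v"
  obtains h where "h \<in> Hom C a (Dom C p)" "Comp C p h = u" "Comp C q h = v"
  using assms unfolding is_pullback_def by blast

lemma is_pullbackD:
  assumes "is_pullback C f g p q"
  shows "f \<in> Hom C (Dom C f) (Cod C g)" "g \<in> Hom C (Dom C g) (Cod C g)"
    "p \<in> Hom C (Dom C p) (Dom C f)" "q \<in> Hom C (Dom C p) (Dom C g)"
    "Comp C f p = Comp C g q"
  using assms by (simp_all add: is_pullback_def Hom_def)

lemma orthogonal_lift:
  assumes "orthogonal C e m" "e \<in> Hom C a b" "m \<in> Hom C c d"
    and "u \<in> Hom C a c" "v \<in> Hom C b d" "Comp C m u = Comp C v e"
  shows "\<exists>!h. h \<in> Hom C b c \<and> Comp C h e = u \<and> Comp C m h = v"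
  using assms by (simp add: orthogonal_def Hom_def)

context category
begin

text \<open>Both maps are lifts of the same cone, so the projections are jointly monic.\<close>

lemma is_pullback_eqI:
  assumes pb: "is_pullback C f g p q"
    and h: "h \<in> Hom C a (Dom C p)" and h': "h' \<in> Hom C a (Dom C p)"
    and eq: "Comp C p h = Comp C p h'" "Comp C q h = Comp C q h'"
  shows "h = h'"
proof -
  note P = is_pullbackD[OF pb]
  have "Comp C p h \<in> Hom C a (Dom C f)" "Comp C q h \<in> Hom C a (Dom C g)"
    using comp_hom h P by blast+
  moreover have "Comp C f (Comp C p h) = Comp C g (Comp C q h)"
    using comp_assoc[OF h P(3,1)] comp_assoc[OF h P(4,2)] P(5) by simp
  ultimately have "\<exists>!l. l \<in> Hom C a (Dom C p) \<and> Comp C p l = Comp C p h \<and> Comp C q l = Comp C q h"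
    using pb unfolding is_pullback_def by blast
  then show ?thesis
    using h h' eq by metis
qed

text \<open>Pasting the given square with the pullback square gives a lifting problem against
  \<open>m\<close>. Its filler \<open>d\<close>, paired with \<open>v\<close>, is the filler against
  \<open>p\<close>. Any other filler composes with \<open>q\<close> to a solution of the pasted
  problem, hence agrees with \<open>d\<close>.\<close>

lemma orthogonal_pullback:
  assumes orth: "orthogonal C e m" and pb: "is_pullback C f m p q" and e: "e \<in> Arr C"
  shows "orthogonal C e p"
  unfolding orthogonal_def
proof (intro allI impI, elim conjE)
  fix u v
  assume u: "u \<in> Hom C (Dom C e) (Dom C p)" and v': "v \<in> Hom C (Cod C e) (Cod C p)"
    and sq: "Comp C p u = Comp C v e"
  note P = is_pullbackD[OF pb]
  have e: "e \<in> Hom C (Dom C e) (Cod C e)" using e by (simp add: Hom_def)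
  have v: "v \<in> Hom C (Cod C e) (Dom C f)" using v' P by (simp add: Hom_def)
  have "Comp C m (Comp C q u) = Comp C (Comp C f v) e"
    using comp_assoc[OF u P(4,2)] comp_assoc[OF u P(3,1)] comp_assoc[OF e v P(1)] P(5) sq by simp
  then have ex1: "\<exists>!d. d \<in> Hom C (Cod C e) (Dom C m) \<and> Comp C d e = Comp C q u
      \<and> Comp C m d = Comp C f v"
    using orthogonal_lift[OF orth e P(2)] comp_hom[OF u P(4)] comp_hom[OF v P(1)] by blast
  then obtain d where d: "d \<in> Hom C (Cod C e) (Dom C m)" "Comp C d e = Comp C q u"
    "Comp C m d = Comp C f v" by blast
  obtain h where h: "h \<in> Hom C (Cod C e) (Dom C p)" "Comp C p h = v" "Comp C q h = d"
    using is_pullback_lift[OF pb v d(1)] d(3) by metis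
  have "Comp C h e = u"
    using comp_assoc[OF e h(1) P(3)] comp_assoc[OF e h(1) P(4)] h d sq
    by (intro is_pullback_eqI[OF pb comp_hom[OF e h(1)] u]) simp_all
  moreover have "h' = h"
    if h': "h' \<in> Hom C (Cod C e) (Dom C p)" "Comp C h' e = u" "Comp C p h' = v" for h'
  proof -
    have "Comp C q h' \<in> Hom C (Cod C e) (Dom C m)" "Comp C (Comp C q h') e = Comp C q u"
      "Comp C m (Comp C q h') = Comp C f v"
      using comp_hom[OF h'(1) P(4)] comp_assoc[OF e h'(1) P(4)] comp_assoc[OF h'(1) P(4,2)]
        comp_assoc[OF h'(1) P(3,1)] P(5) h' by simp_all
    then have "Comp C q h' = d" using ex1 d by blast
    then show ?thesis
      using is_pullback_eqI[OF pb h'(1) h(1)] h h' by simp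
  qed
  ultimately show "\<exists>!d. d \<in> Hom C (Cod C e) (Dom C p) \<and> Comp C d e = u \<and> Comp C p d = v"
    using h by blast
qed

end

text \<open>The objects of the cospan \<open>0 \<rightarrow> 2 \<leftarrow> 1\<close> double as its identity arrows; the other two
  arrows are \<open>3 : 0 \<rightarrow> 2\<close> and \<open>4 : 1 \<rightarrow> 2\<close>.\<close>

definition cospan_cat :: "(nat, nat) cat" where
  "cospan_cat = \<lparr>Obj = {0, 1, 2}, Arr = {0, 1, 2, 3, 4},
    Dom = (\<lambda>u. if u = 3 then 0 else if u = 4 then 1 else u),
    Cod = (\<lambda>u. if u = 3 \<or> u = 4 then 2 else u),
    Ident = (\<lambda>a. a), Comp = (\<lambda>g f. if f < 3 then g else f)\<rparr>"

lemma category_cospan_cat: "category cospan_cat"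
  by unfold_locales (auto simp: cospan_cat_def Hom_def split: if_splits)

lemma (in category) is_pullback_exists:
  assumes fin: "finitely_complete C" and f: "f \<in> Hom C a c" and g: "g \<in> Hom C b c"
  obtains p q where "is_pullback C f g p q"
proof -
  define Do where "Do j = (if j = 0 then a else if j = 1 then b else c)" for j :: nat
  define Da where "Da u = (if u = 3 then f else if u = 4 then g else Ident C (Do u))" for u :: nat
  have obj: "a \<in> Obj C" "b \<in> Obj C" "c \<in> Obj C"
    using f g hom_dom_obj hom_cod_obj by blast+
  interpret J: category cospan_cat by (rule category_cospan_cat)
  have "cat_functor cospan_cat C Do Da"
  proof
    show "Do j \<in> Obj C" if "j \<in> Obj cospan_cat" for j
      using that obj by (auto simp: Do_def)
    show Da: "Da u \<in> Hom C (Do i) (Do j)" if "u \<in> Hom cospan_cat i j" for u i j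
      using HomD[OF that] f g ident_hom obj
      by (auto simp: Da_def Do_def cospan_cat_def)
    show "Da (Ident cospan_cat j) = Ident C (Do j)" if "j \<in> Obj cospan_cat" for j
      using that by (auto simp: Da_def cospan_cat_def)
    show "Da (Comp cospan_cat v u) = Comp C (Da v) (Da u)"
      if "u \<in> Hom cospan_cat i j" "v \<in> Hom cospan_cat j k" for u v i j k
    proof -
      \<comment> \<open>In a composable pair of arrows of the cospan at least one is an identity, so
        no composite other than the identity laws has to be checked. For the same reason
        \<open>Comp\<close> in \<open>cospan_cat\<close> just picks one of its arguments.\<close>
      have "u = i \<and> i = j \<and> i \<le> 2 \<or> u \<in> {3, 4} \<and> v = j \<and> j = 2"
        using that by (auto simp: cospan_cat_def Hom_def split: if_splits)
      then show ?thesis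
        using comp_ident_right[OF Da[OF that(2)]] comp_ident_left[OF Da[OF that(1)]]
        by (auto simp: cospan_cat_def Da_def)
    qed
  qed
  then obtain l r where lim: "limit_cone cospan_cat C Do Da l r"
    using fin unfolding finitely_complete_def by (fastforce simp: cospan_cat_def)
  \<comment> \<open>The leg at \<open>2\<close> is forced by either of the other two, so cones over
    the cospan are commuting squares on \<open>f\<close> and \<open>g\<close>.\<close>
  have cone_iff: "cone cospan_cat C Do Da d s \<longleftrightarrow> s 0 \<in> Hom C d a \<and> s 1 \<in> Hom C d b \<and>
      s 2 = Comp C f (s 0) \<and> s 2 = Comp C g (s 1)" for d s
    using hom_dom_obj comp_ident_left[OF comp_hom[OF _ f]] comp_ident_left[of "s 0" d a]
      comp_ident_left[of "s 1" d b] comp_hom[OF _ f]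
    by (auto simp: cone_def cospan_cat_def Do_def Da_def)
  have r: "r 0 \<in> Hom C l a" "r 1 \<in> Hom C l b" "r 2 = Comp C f (r 0)" "r 2 = Comp C g (r 1)"
    using lim unfolding limit_cone_def cone_iff by auto
  have "\<exists>!h. h \<in> Hom C d l \<and> Comp C (r 0) h = u \<and> Comp C (r 1) h = v"
    if u: "u \<in> Hom C d a" and v: "v \<in> Hom C d b" and eq: "Comp C f u = Comp C g v" for d u v
  proof -
    define s where "s j = (if j = 0 then u else if j = 1 then v else Comp C f u)" for j :: nat
    have "cone cospan_cat C Do Da d s"
      unfolding cone_iff using u v eq by (simp add: s_def)
    then have "\<exists>!h. h \<in> Hom C d l \<and> (\<forall>j \<in> Obj cospan_cat. Comp C (r j) h = s j)"
      using lim unfolding limit_cone_def by blast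
    moreover have "(\<forall>j \<in> Obj cospan_cat. Comp C (r j) h = s j) \<longleftrightarrow>
        Comp C (r 0) h = u \<and> Comp C (r 1) h = v" if "h \<in> Hom C d l" for h
      using comp_assoc[OF that r(1) f] r(3) by (auto simp: cospan_cat_def s_def)
    ultimately show ?thesis by (metis (no_types, lifting))
  qed
  then have "is_pullback C f g (r 0) (r 1)"
    using f g r unfolding is_pullback_def by (auto simp: Hom_def)
  then show thesis by (rule that)
qed

section \<open>Factorization systems\<close>

context factorization_system
begin

lemma orthogonal_left_right: "\<lbrakk>e \<in> left_class F; m \<in> right_class F\<rbrakk> \<Longrightarrow> orthogonal C e m"
  using left_class_eq by blast

lemma left_class_arr: "e \<in> left_class F \<Longrightarrow> e \<in> Arr C"
  and right_class_arr: "m \<in> right_class F \<Longrightarrow> m \<in> Arr C"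
  using left_class_eq right_class_eq by blast+

lemma right_class_pullback:
  assumes "m \<in> right_class F" "is_pullback C f m p q"
  shows "p \<in> right_class F"
proof -
  have "p \<in> Arr C" using assms(2) by (simp add: is_pullback_def)
  then show ?thesis
    using assms orthogonal_left_right orthogonal_pullback left_class_arr
    by (subst right_class_eq) blast
qed

lemma fac_hom:
  assumes "f \<in> Hom C a b"
  shows "left_fac F f \<in> Hom C a (Dom C (right_fac F f))"
    and "right_fac F f \<in> Hom C (Dom C (right_fac F f)) b"
proof -
  have f: "f \<in> Arr C" "Dom C f = a" "Cod C f = b" using HomD[OF assms] .
  show "left_fac F f \<in> Hom C a (Dom C (right_fac F f))"
    "right_fac F f \<in> Hom C (Dom C (right_fac F f)) b"
    using comp_arr[of "left_fac F f" "right_fac F f"] f left_class_arr[OF left_fac]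
      right_class_arr[OF right_fac] fac_composable fac_comp by (auto simp: Hom_def)
qed

text \<open>A Yoneda-type principle: the left factor of \<open>x\<close> is orthogonal to the right
  factor of \<open>y\<close>, so a map of slices over \<open>b\<close> is determined by its
  composite with \<open>left_fac F x\<close>, and every \<open>v\<close> lying over \<open>x\<close>
  occurs as such a composite.\<close>

lemma ex1_slice_map:
  assumes x: "x \<in> Hom C a b" and y: "y \<in> Hom C a' b"
    and v: "v \<in> Hom C a (Dom C (right_fac F y))" "Comp C (right_fac F y) v = x"
  shows "\<exists>!h. h \<in> Hom C (Dom C (right_fac F x)) (Dom C (right_fac F y)) \<and>
    Comp C h (left_fac F x) = v \<and> Comp C (right_fac F y) h = right_fac F x"
  by (rule orthogonal_lift[OF _ fac_hom(1)[OF x] fac_hom(2)[OF y] v(1) fac_hom(2)[OF x]])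
    (use HomD[OF x] HomD[OF y] v in \<open>auto simp: fac_comp left_fac right_fac
      intro: orthogonal_left_right\<close>)

end

section \<open>Duality of slices and coslices\<close>

definition slice_hom :: "('o, 'a) cat \<Rightarrow> 'a \<Rightarrow> 'a \<Rightarrow> 'a set" where
  "slice_hom C f g = {h \<in> Hom C (Dom C f) (Dom C g). Comp C g h = f}"

lemma slice_homD:
  assumes "h \<in> slice_hom C f g"
  shows "h \<in> Hom C (Dom C f) (Dom C g)" "Comp C g h = f"
  using assms by (simp_all add: slice_hom_def)

text \<open>The object \<open>s\<close> with \<open>t\<close> ranges over \<M>/1, and
  \<open>a\<close>, \<open>b\<close> are the two points to be identified. Quantifying over all
  pullbacks instead of fixing one keeps the relation free of choices and lets it be transported
  along the exchange of the two systems.\<close>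

definition dual_maps ::
  "('o, 'a) cat \<Rightarrow> 'o \<Rightarrow> 'a fact_sys \<Rightarrow> 'a fact_sys \<Rightarrow> 'a \<Rightarrow> 'a \<Rightarrow> 'a \<Rightarrow> 'a \<Rightarrow> bool" where
  "dual_maps C one F F' x y h k \<longleftrightarrow> (\<forall>p q s t g a b.
    is_pullback C (right_fac F' x) (right_fac F y) p q \<and>
    t \<in> Hom C s one \<and> t \<in> right_class F \<and> g \<in> Hom C (Dom C p) s \<and>
    a \<in> Hom C one (Dom C p) \<and>
    Comp C p a = left_fac F' x \<and> Comp C q a = Comp C h (left_fac F x) \<and>
    b \<in> Hom C one (Dom C p) \<and>
    Comp C p b = Comp C k (left_fac F' y) \<and> Comp C q b = left_fac F y \<longrightarrow>
    Comp C g a = Comp C g b)"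

context balanced_factorization_category
begin

text \<open>The axioms are symmetric in the two systems, so every result below also holds with
  \<open>F\<close> and \<open>F'\<close> exchanged.\<close>

lemma balanced_swap: "balanced_factorization_category C one F' F"
  by unfold_locales
    (auto simp: finitely_complete terminal_one right_classes_over_one
      intro: pullback_left pullback_left')

text \<open>Exchanging the projections of the pullback exchanges the roles of the points
  \<open>a\<close> and \<open>b\<close>, and the test objects are the same because \<M>/1 =
  \<M>'/1.\<close>

lemma dual_maps_swap:
  assumes "dual_maps C one F F' x y h k"
  shows "dual_maps C one F' F y x k h"
  unfolding dual_maps_def
proof (intro allI impI, elim conjE)
  fix p q s t g a b
  assume pb: "is_pullback C (right_fac F y) (right_fac F' x) p q"
    and t: "t \<in> Hom C s one" "t \<in> right_class F'"
    and g: "g \<in> Hom C (Dom C p) s" and a: "a \<in> Hom C one (Dom C p)"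
    and b: "b \<in> Hom C one (Dom C p)"
    and eq: "Comp C p a = left_fac F y" "Comp C q a = Comp C k (left_fac F' y)"
      "Comp C p b = Comp C h (left_fac F x)" "Comp C q b = left_fac F' x"
  have "Dom C q = Dom C p" using pb by (simp add: is_pullback_def)
  moreover have "t \<in> right_class F"
    using right_classes_over_one fs.hom_dom_obj t by blast
  ultimately have "Comp C g b = Comp C g a"
    using assms[unfolded dual_maps_def, rule_format, of q p t s g b a] is_pullback_sym[OF pb]
      t(1) g a b eq by simp
  then show "Comp C g a = Comp C g b" ..
qed

text \<open>For identities the two points have equal projections, so they coincide already in the
  pullback.\<close>

lemma dual_maps_ident:
  assumes x: "x \<in> Hom C one X"
  shows "dual_maps C one F F' x x (Ident C (Dom C (right_fac F x)))
    (Ident C (Dom C (right_fac F' x)))"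
  unfolding dual_maps_def fs.comp_ident_left[OF fs.fac_hom(1)[OF x]]
    fs.comp_ident_left[OF fs'.fac_hom(1)[OF x]]
proof (intro allI impI, elim conjE)
  fix p q s t g a b
  assume pb: "is_pullback C (right_fac F' x) (right_fac F x) p q"
    and a: "a \<in> Hom C one (Dom C p)" and b: "b \<in> Hom C one (Dom C p)"
    and "Comp C p a = left_fac F' x" "Comp C p b = left_fac F' x"
    and "Comp C q a = left_fac F x" "Comp C q b = left_fac F x"
  then have "a = b" using fs.is_pullback_eqI[OF pb a b] by simp
  then show "Comp C g a = Comp C g b" by simp
qed

section \<open>Existence and uniqueness of the dual of a map of slices\<close>

context
  fixes X x y h k
  assumes x: "x \<in> Hom C one X" and y: "y \<in> Hom C one X"
    and h: "h \<in> slice_hom C (right_fac F x) (right_fac F y)"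
begin

text \<open>The two components agree over \<open>X\<close>: both composites equal \<open>x\<close>,
  since \<open>h\<close> is a map over \<open>X\<close>.\<close>

lemma source_point:
  assumes "is_pullback C (right_fac F' x) (right_fac F y) p q"
  obtains a where "a \<in> Hom C one (Dom C p)" "Comp C p a = left_fac F' x"
    "Comp C q a = Comp C h (left_fac F x)"
proof (rule is_pullback_lift[OF assms fs'.fac_hom(1)[OF x]])
  note e = fs.fac_hom(1)[OF x] and h = slice_homD[OF h]
  show "Comp C h (left_fac F x) \<in> Hom C one (Dom C (right_fac F y))"
    by (rule fs.comp_hom[OF e h(1)])
  show "Comp C (right_fac F' x) (left_fac F' x) =
      Comp C (right_fac F y) (Comp C h (left_fac F x))"
    using fs.comp_assoc[OF e h(1) fs.fac_hom(2)[OF y]] h(2) fs.fac_comp fs'.fac_comp HomD(1)[OF x]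
    by simp
qed (use that in blast)

lemma ex1_dual_maps:
  "\<exists>!k. k \<in> slice_hom C (right_fac F' y) (right_fac F' x) \<and> dual_maps C one F F' x y h k"
proof -
  have one: "one \<in> Obj C" and one_eq: "\<And>s f g. f \<in> Hom C s one \<Longrightarrow> g \<in> Hom C s one \<Longrightarrow> f = g"
    using terminal_one fs.hom_dom_obj unfolding terminal_def by blast+
  obtain p q where pb: "is_pullback C (right_fac F' x) (right_fac F y) p q"
    using fs.is_pullback_exists[OF finitely_complete fs'.fac_hom(2)[OF x] fs.fac_hom(2)[OF y]] .
  note P = is_pullbackD[OF pb]
  have xA: "x \<in> Arr C" and yA: "y \<in> Arr C" using HomD(1)[OF x] HomD(1)[OF y] .
  have q: "q \<in> right_class F'"
    using fs'.right_class_pullback[OF fs'.right_fac[OF xA] is_pullback_sym[OF pb]] .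
  \<comment> \<open>The domain of \<open>t0\<close> is the object \<open>T\<close> of the overview:
    the fibre of \<open>q\<close> over the point \<open>left_fac F y\<close>.\<close>
  obtain t0 t where pbT: "is_pullback C (left_fac F y) q t0 t"
    using fs.is_pullback_exists[OF finitely_complete fs.fac_hom(1)[OF y] P(4)] .
  have t0': "t0 \<in> Hom C (Dom C t0) one" and t': "t \<in> Hom C (Dom C t0) (Dom C p)"
    and qt: "Comp C (left_fac F y) t0 = Comp C q t"
    using is_pullbackD[OF pbT] HomD[OF fs.fac_hom(1)[OF y]] HomD[OF P(4)] by auto
  have t: "t \<in> left_class F"
    using pullback_left[OF fs.left_fac[OF yA] q pbT] .
  have "t0 \<in> right_class F'"
    using fs'.right_class_pullback[OF q pbT] .
  then have t0: "t0 \<in> right_class F"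
    using right_classes_over_one[OF fs.hom_dom_obj[OF t0'] t0'] by simp
  \<comment> \<open>As \<open>t\<close> is in \<E>, maps into objects of \<M>/1 extend uniquely
    along it; the triangle over the terminal object commutes automatically.\<close>
  have ext: "\<exists>!d. d \<in> Hom C (Dom C p) s \<and> Comp C d t = u"
    if s: "m \<in> Hom C s one" "m \<in> right_class F" and u: "u \<in> Hom C (Dom C t0) s" for m s u
  proof -
    obtain n where n: "n \<in> Hom C (Dom C p) one"
      using terminal_one fs.hom_dom_obj[OF P(3)] unfolding terminal_def by blast
    have "Comp C m u = Comp C n t"
      using one_eq fs.comp_hom[OF u s(1)] fs.comp_hom[OF t' n] .
    then have "\<exists>!d. d \<in> Hom C (Dom C p) s \<and> Comp C d t = u \<and> Comp C m d = n"
      using orthogonal_lift[OF fs.orthogonal_left_right[OF t s(2)] t' s(1) u n] by blast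
    moreover have "Comp C m d = n" if "d \<in> Hom C (Dom C p) s" for d
      using one_eq fs.comp_hom[OF that s(1)] n .
    ultimately show ?thesis by metis
  qed
  \<comment> \<open>The retraction is the extension of the identity of \<open>T\<close>, which is
    possible because \<open>T\<close> is itself in \<M>/1.\<close>
  obtain r where r: "r \<in> Hom C (Dom C p) (Dom C t0)" "Comp C r t = Ident C (Dom C t0)"
    using ext[OF t0' t0 fs.ident_hom[OF fs.hom_dom_obj[OF t0']]] by blast
  obtain a where a: "a \<in> Hom C one (Dom C p)" "Comp C p a = left_fac F' x"
    "Comp C q a = Comp C h (left_fac F x)"
    using source_point[OF pb] .
  \<comment> \<open>The reflection of \<open>a\<close> into the fibre, viewed again as a point of
    the pullback. It is the only candidate for the second point of a dual pair.\<close>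
  define b where "b = Comp C t (Comp C r a)"
  have ra: "Comp C r a \<in> Hom C one (Dom C t0)" using fs.comp_hom[OF a(1) r(1)] .
  have b: "b \<in> Hom C one (Dom C p)" unfolding b_def using fs.comp_hom[OF ra t'] .
  have qb: "Comp C q b = left_fac F y"
  proof -
    have "Comp C q b = Comp C (left_fac F y) (Comp C t0 (Comp C r a))"
      unfolding b_def
      using fs.comp_assoc[OF ra t' P(4)] fs.comp_assoc[OF ra t0' fs.fac_hom(1)[OF y]] qt by simp
    also have "Comp C t0 (Comp C r a) = Ident C one"
      using one_eq fs.comp_hom[OF ra t0'] fs.ident_hom[OF one] .
    finally show ?thesis using fs.comp_ident_right[OF fs.fac_hom(1)[OF y]] by simp
  qed
  \<comment> \<open>Thus \<open>Comp C p b\<close> is a point of the coslice under \<open>x\<close>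
    lying over \<open>y\<close>, and by \<open>ex1_slice_map\<close> it is the value at
    \<open>left_fac F' y\<close> of exactly one map over \<open>X\<close>.\<close>
  have pb_y: "Comp C (right_fac F' x) (Comp C p b) = y"
    using fs.comp_assoc[OF b P(3,1)] fs.comp_assoc[OF b P(4,2)] P(5) qb fs.fac_comp[OF yA] by simp
  have ex1_k: "\<exists>!k. k \<in> Hom C (Dom C (right_fac F' y)) (Dom C (right_fac F' x)) \<and>
      Comp C k (left_fac F' y) = Comp C p b \<and> Comp C (right_fac F' x) k = right_fac F' y"
    using fs'.ex1_slice_map[OF y x fs.comp_hom[OF b P(3)] pb_y] .
  have dual_iff: "dual_maps C one F F' x y h k \<longleftrightarrow> Comp C k (left_fac F' y) = Comp C p b"
    if k: "k \<in> slice_hom C (right_fac F' y) (right_fac F' x)" for k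
  proof
    note k = slice_homD[OF k]
    assume dual: "dual_maps C one F F' x y h k"
    have "Comp C k (left_fac F' y) \<in> Hom C one (Dom C (right_fac F' x))"
      using fs.comp_hom[OF fs'.fac_hom(1)[OF y] k(1)] .
    moreover have "Comp C (right_fac F' x) (Comp C k (left_fac F' y)) =
        Comp C (right_fac F y) (left_fac F y)"
      using fs.comp_assoc[OF fs'.fac_hom(1)[OF y] k(1) fs'.fac_hom(2)[OF x]] k(2)
        fs.fac_comp[OF yA] fs'.fac_comp[OF yA] by simp
    ultimately obtain b' where b': "b' \<in> Hom C one (Dom C p)"
      "Comp C p b' = Comp C k (left_fac F' y)" "Comp C q b' = left_fac F y"
      using is_pullback_lift[OF pb _ fs.fac_hom(1)[OF y]] by metis
    have "Comp C (left_fac F y) (Ident C one) = Comp C q b'"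
      using fs.comp_ident_right[OF fs.fac_hom(1)[OF y]] b'(3) by simp
    \<comment> \<open>Since \<open>b'\<close> lies over the point \<open>left_fac F y\<close>, it
      factors through the fibre.\<close>
    then obtain c where c: "c \<in> Hom C one (Dom C t0)" "Comp C t c = b'"
      using is_pullback_lift[OF pbT] fs.ident_hom[OF one] b'(1) HomD[OF fs.fac_hom(1)[OF y]]
        HomD[OF P(4)] by metis
    \<comment> \<open>Duality is tested on the single map \<open>r\<close>, which is legitimate
      because its codomain \<open>T\<close> is in \<M>/1.\<close>
    have "Comp C r a = Comp C r b'"
      using dual pb t0' t0 r(1) a b' unfolding dual_maps_def by blast
    also have "\<dots> = c"
      using fs.comp_assoc[OF c(1) t' r(1)] r(2) c fs.comp_ident_left by simp
    finally have "b' = b" using c(2) by (simp add: b_def)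
    then show "Comp C k (left_fac F' y) = Comp C p b" using b'(2) by simp
  next
    assume kb: "Comp C k (left_fac F' y) = Comp C p b"
    show "dual_maps C one F F' x y h k"
      unfolding dual_maps_def
    proof (intro allI impI, elim conjE)
      fix p' q' s m g a' b'
      assume pb': "is_pullback C (right_fac F' x) (right_fac F y) p' q'"
        and m: "m \<in> Hom C s one" "m \<in> right_class F" and g: "g \<in> Hom C (Dom C p') s"
        and a': "a' \<in> Hom C one (Dom C p')" "Comp C p' a' = left_fac F' x"
          "Comp C q' a' = Comp C h (left_fac F x)"
        and b': "b' \<in> Hom C one (Dom C p')" "Comp C p' b' = Comp C k (left_fac F' y)"
          "Comp C q' b' = left_fac F y"
      note P' = is_pullbackD[OF pb']
      \<comment> \<open>The comparison map from the fixed pullback to the arbitrary one carries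
        \<open>a\<close> and \<open>b\<close> to \<open>a'\<close> and \<open>b'\<close>, so the
        test map \<open>g\<close> may be replaced by \<open>Comp C g l\<close>.\<close>
      obtain l where l: "l \<in> Hom C (Dom C p) (Dom C p')" "Comp C p' l = p" "Comp C q' l = q"
        using is_pullback_lift[OF pb' P(3,4,5)] .
      have "Comp C l a = a'"
        using fs.comp_assoc[OF a(1) l(1) P'(3)] fs.comp_assoc[OF a(1) l(1) P'(4)] l a a'
        by (intro fs.is_pullback_eqI[OF pb' fs.comp_hom[OF a(1) l(1)] a'(1)]) simp_all
      moreover have "Comp C l b = b'"
        using fs.comp_assoc[OF b l(1) P'(3)] fs.comp_assoc[OF b l(1) P'(4)] l b' kb qb
        by (intro fs.is_pullback_eqI[OF pb' fs.comp_hom[OF b l(1)] b'(1)]) simp_all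
      moreover have gl: "Comp C g l \<in> Hom C (Dom C p) s"
        using fs.comp_hom[OF l(1) g] .
      moreover have "Comp C (Comp C g l) a = Comp C (Comp C g l) b"
      proof -
        let ?g = "Comp C g l"
        have gt: "Comp C ?g t \<in> Hom C (Dom C t0) s" using fs.comp_hom[OF t' gl] .
        have "Comp C (Comp C (Comp C ?g t) r) t = Comp C ?g t"
          using fs.comp_assoc[OF t' r(1) gt] r(2) fs.comp_ident_right[OF gt] by simp
        \<comment> \<open>Both sides extend \<open>Comp C ?g t\<close> along \<open>t\<close>. So
          \<open>?g\<close> factors through \<open>r\<close> and takes the same value at
          \<open>a\<close> as at its reflection \<open>b\<close>.\<close>
        then have "?g = Comp C (Comp C ?g t) r"
          using ext[OF m gt] gl fs.comp_hom[OF r(1) gt] by blast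
        then show ?thesis
          unfolding b_def
          using fs.comp_assoc[OF ra t' gl] fs.comp_assoc[OF a(1) r(1) gt] by simp
      qed
      ultimately show "Comp C g a' = Comp C g b'"
        using fs.comp_assoc[OF a(1) l(1) g] fs.comp_assoc[OF b l(1) g] by simp
    qed
  qed
  have "k \<in> slice_hom C (right_fac F' y) (right_fac F' x) \<and> dual_maps C one F F' x y h k \<longleftrightarrow>
      k \<in> Hom C (Dom C (right_fac F' y)) (Dom C (right_fac F' x)) \<and>
      Comp C k (left_fac F' y) = Comp C p b \<and> Comp C (right_fac F' x) k = right_fac F' y" for k
    using dual_iff[of k] by (auto simp: slice_hom_def)
  then show ?thesis
    using ex1_k by simp
qed

end

section \<open>Compatibility of duality with composition\<close>

lemma target_point:
  assumes x: "x \<in> Hom C one X" and y: "y \<in> Hom C one X"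
    and k: "k \<in> slice_hom C (right_fac F' y) (right_fac F' x)"
    and pb: "is_pullback C (right_fac F' x) (right_fac F y) p q"
  obtains b where "b \<in> Hom C one (Dom C p)" "Comp C p b = Comp C k (left_fac F' y)"
    "Comp C q b = left_fac F y"
proof -
  \<comment> \<open>This is \<open>source_point\<close> for the exchanged systems, applied to the
    pullback with its projections interchanged.\<close>
  interpret swap: balanced_factorization_category C one F' F by (rule balanced_swap)
  have "Dom C q = Dom C p" using pb by (simp add: is_pullback_def)
  then show thesis
    using swap.source_point[OF y x k is_pullback_sym[OF pb]] that by metis
qed

text \<open>The pullback for \<open>x\<close>, \<open>z\<close> receives the one for
  \<open>x\<close>, \<open>y\<close> by applying \<open>h'\<close> to the second component, and the
  one for \<open>y\<close>, \<open>z\<close> by applying \<open>k\<close> to the first. The image of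
  the second point of the former equals the image of the first point of the latter, so the two
  identifications chain together.\<close>

lemma dual_maps_comp:
  assumes x: "x \<in> Hom C one X" and y: "y \<in> Hom C one X" and z: "z \<in> Hom C one X"
    and h: "h \<in> slice_hom C (right_fac F x) (right_fac F y)"
    and h': "h' \<in> slice_hom C (right_fac F y) (right_fac F z)"
    and k: "k \<in> slice_hom C (right_fac F' y) (right_fac F' x)"
    and k': "k' \<in> slice_hom C (right_fac F' z) (right_fac F' y)"
    and dual: "dual_maps C one F F' x y h k" and dual': "dual_maps C one F F' y z h' k'"
  shows "dual_maps C one F F' x z (Comp C h' h) (Comp C k k')"
  unfolding dual_maps_def
proof (intro allI impI, elim conjE)
  fix p q s t g a b
  assume pb: "is_pullback C (right_fac F' x) (right_fac F z) p q"
    and t: "t \<in> Hom C s one" "t \<in> right_class F" and g: "g \<in> Hom C (Dom C p) s"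
    and a: "a \<in> Hom C one (Dom C p)" "Comp C p a = left_fac F' x"
      "Comp C q a = Comp C (Comp C h' h) (left_fac F x)"
    and b: "b \<in> Hom C one (Dom C p)" "Comp C p b = Comp C (Comp C k k') (left_fac F' z)"
      "Comp C q b = left_fac F z"
  note P = is_pullbackD[OF pb]
  note h = h slice_homD[OF h] and h' = h' slice_homD[OF h']
    and k = k slice_homD[OF k] and k' = k' slice_homD[OF k']
  obtain p1 q1 where pb1: "is_pullback C (right_fac F' x) (right_fac F y) p1 q1"
    using fs.is_pullback_exists[OF finitely_complete fs'.fac_hom(2)[OF x] fs.fac_hom(2)[OF y]] .
  note P1 = is_pullbackD[OF pb1]
  obtain p2 q2 where pb2: "is_pullback C (right_fac F' y) (right_fac F z) p2 q2"
    using fs.is_pullback_exists[OF finitely_complete fs'.fac_hom(2)[OF y] fs.fac_hom(2)[OF z]] .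
  note P2 = is_pullbackD[OF pb2]
  have "Comp C (right_fac F' x) p1 = Comp C (right_fac F z) (Comp C h' q1)"
    using P1(5) fs.comp_assoc[OF P1(4) h'(2) P(2)] h'(3) by simp
  then obtain l1 where l1: "l1 \<in> Hom C (Dom C p1) (Dom C p)" "Comp C p l1 = p1"
    "Comp C q l1 = Comp C h' q1"
    using is_pullback_lift[OF pb P1(3) fs.comp_hom[OF P1(4) h'(2)]] by metis
  have "Comp C (right_fac F' x) (Comp C k p2) = Comp C (right_fac F z) q2"
    using P2(5) fs.comp_assoc[OF P2(3) k(2) P(1)] k(3) by simp
  then obtain l2 where l2: "l2 \<in> Hom C (Dom C p2) (Dom C p)" "Comp C p l2 = Comp C k p2"
    "Comp C q l2 = q2"
    using is_pullback_lift[OF pb fs.comp_hom[OF P2(3) k(2)] P2(4)] by metis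
  obtain a1 where a1: "a1 \<in> Hom C one (Dom C p1)" "Comp C p1 a1 = left_fac F' x"
    "Comp C q1 a1 = Comp C h (left_fac F x)"
    using source_point[OF x y h(1) pb1] .
  obtain b1 where b1: "b1 \<in> Hom C one (Dom C p1)" "Comp C p1 b1 = Comp C k (left_fac F' y)"
    "Comp C q1 b1 = left_fac F y"
    using target_point[OF x y k(1) pb1] .
  obtain a2 where a2: "a2 \<in> Hom C one (Dom C p2)" "Comp C p2 a2 = left_fac F' y"
    "Comp C q2 a2 = Comp C h' (left_fac F y)"
    using source_point[OF y z h'(1) pb2] .
  obtain b2 where b2: "b2 \<in> Hom C one (Dom C p2)" "Comp C p2 b2 = Comp C k' (left_fac F' z)"
    "Comp C q2 b2 = left_fac F z"
    using target_point[OF y z k'(1) pb2] .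
  have l1_comp: "Comp C p (Comp C l1 c) = Comp C p1 c"
    "Comp C q (Comp C l1 c) = Comp C h' (Comp C q1 c)" if "c \<in> Hom C one (Dom C p1)" for c
    using fs.comp_assoc[OF that l1(1) P(3)] fs.comp_assoc[OF that l1(1) P(4)]
      fs.comp_assoc[OF that P1(4) h'(2)] l1 by simp_all
  have l2_comp: "Comp C p (Comp C l2 c) = Comp C k (Comp C p2 c)"
    "Comp C q (Comp C l2 c) = Comp C q2 c" if "c \<in> Hom C one (Dom C p2)" for c
    using fs.comp_assoc[OF that l2(1) P(3)] fs.comp_assoc[OF that l2(1) P(4)]
      fs.comp_assoc[OF that P2(3) k(2)] l2 by simp_all
  have "Comp C l1 a1 = a"
    using l1_comp[OF a1(1)] a1 a fs.comp_assoc[OF fs.fac_hom(1)[OF x] h(2) h'(2)]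
    by (intro fs.is_pullback_eqI[OF pb fs.comp_hom[OF a1(1) l1(1)] a(1)]) simp_all
  \<comment> \<open>The common middle point has components \<open>Comp C k (left_fac F' y)\<close>
    and \<open>Comp C h' (left_fac F y)\<close>.\<close>
  moreover have "Comp C l1 b1 = Comp C l2 a2"
    using l1_comp[OF b1(1)] l2_comp[OF a2(1)] b1 a2
    by (intro fs.is_pullback_eqI[OF pb fs.comp_hom[OF b1(1) l1(1)] fs.comp_hom[OF a2(1) l2(1)]])
      simp_all
  moreover have "Comp C l2 b2 = b"
    using l2_comp[OF b2(1)] b2 b fs.comp_assoc[OF fs'.fac_hom(1)[OF z] k'(2) k(2)]
    by (intro fs.is_pullback_eqI[OF pb fs.comp_hom[OF b2(1) l2(1)] b(1)]) simp_all
  moreover have "Comp C (Comp C g l1) a1 = Comp C (Comp C g l1) b1"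
    using dual pb1 t fs.comp_hom[OF l1(1) g] a1 b1 unfolding dual_maps_def by blast
  moreover have "Comp C (Comp C g l2) a2 = Comp C (Comp C g l2) b2"
    using dual' pb2 t fs.comp_hom[OF l2(1) g] a2 b2 unfolding dual_maps_def by blast
  ultimately show "Comp C g a = Comp C g b"
    using fs.comp_assoc[OF a1(1) l1(1) g] fs.comp_assoc[OF b1(1) l1(1) g]
      fs.comp_assoc[OF a2(1) l2(1) g] fs.comp_assoc[OF b2(1) l2(1) g] by simp
qed

end

section \<open>The underlying categories\<close>

context factorization_system
begin

lemma category_underlying_cat: "category (underlying_cat C one F X)"
  unfolding underlying_cat_def
  by (rule category.category_induced_cat[OF category_slice_cat])
    (auto simp: slice_cat_def intro: fac_hom(2)[THEN HomD(1)] fac_hom(2)[THEN HomD(3)])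

text \<open>Strips the two layers of source and target tags, so that arrows can be handled as
  elements of \<open>slice_hom\<close>.\<close>

lemma Hom_underlying_cat:
  "f \<in> Hom (underlying_cat C one F X) x y \<longleftrightarrow> x \<in> Hom C one X \<and> y \<in> Hom C one X \<and>
    (\<exists>h \<in> slice_hom C (right_fac F x) (right_fac F y).
      f = (x, (right_fac F x, h, right_fac F y), y))"
  unfolding Hom_def[of "underlying_cat C one F X"]
  unfolding underlying_cat_def induced_cat_def Hom_def[of "slice_cat C X"]
  unfolding slice_cat_def slice_hom_def
  by (auto intro: fac_hom(2)[THEN HomD(1)] fac_hom(2)[THEN HomD(3)])

end

lemma underlying_cat_simps:
  "Obj (underlying_cat C one F X) = Hom C one X"
  "Ident (underlying_cat C one F X) x =
    (x, (right_fac F x, Ident C (Dom C (right_fac F x)), right_fac F x), x)"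
  "Comp (underlying_cat C one F X) (y', (f', h', g'), z) (x, (f, h, g), y) =
    (x, (f, Comp C h' h, g'), z)"
  by (simp_all add: underlying_cat_def induced_cat_def slice_cat_def)

lemma op_cat_simps:
  "Obj (op_cat C) = Obj C" "Ident (op_cat C) = Ident C"
  "Comp (op_cat C) g f = Comp C f g" "Hom (op_cat C) a b = Hom C b a"
  by (auto simp: op_cat_def Hom_def)

theorem corollary4p12:
  fixes C :: "('o, 'a) cat" and one X :: 'o and F F' :: "'a fact_sys"
  assumes "balanced_factorization_category C one F F'"
    and "X \<in> Obj C"
  shows "isomorphic_categories (underlying_cat C one F' X) (op_cat (underlying_cat C one F X))"
proof -
  interpret balanced_factorization_category C one F F' by (rule assms(1))
  interpret swap: balanced_factorization_category C one F' F by (rule balanced_swap)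
  let ?U = "underlying_cat C one F X" and ?U' = "underlying_cat C one F' X"
  \<comment> \<open>A coslice map \<open>k\<close> from \<open>y\<close> to \<open>x\<close> is
    related to a slice map \<open>h\<close> from \<open>x\<close> to \<open>y\<close>. The end
    points are read off the first arrow only, as \<open>R\<close> is applied to arrows with matching
    ends.\<close>
  define R where "R = (\<lambda>(y :: 'a, (_ :: 'a, k, _ :: 'a), x :: 'a)
    (_ :: 'a, (_ :: 'a, h, _ :: 'a), _ :: 'a). dual_maps C one F F' x y h k)"
  show ?thesis
  proof (rule isomorphic_categories_if_bijective_relation[where R = R])
    show "category ?U'" by (rule fs'.category_underlying_cat)
    show "category (op_cat ?U)"
      by (rule category.category_op_cat[OF fs.category_underlying_cat])
    show "Obj (op_cat ?U) = Obj ?U'" by (simp add: underlying_cat_simps op_cat_simps)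
  next
    fix y x f
    assume "f \<in> Hom ?U' y x"
    then obtain k where x: "x \<in> Hom C one X" and y: "y \<in> Hom C one X"
      and k: "k \<in> slice_hom C (right_fac F' y) (right_fac F' x)"
      and f: "f = (y, (right_fac F' y, k, right_fac F' x), x)"
      unfolding fs'.Hom_underlying_cat by blast
    \<comment> \<open>Unique existence for the exchanged systems, carried back by the two directions
      of the swap.\<close>
    have "\<exists>!h. h \<in> slice_hom C (right_fac F x) (right_fac F y) \<and> dual_maps C one F F' x y h k"
      using swap.ex1_dual_maps[OF y x k] dual_maps_swap swap.dual_maps_swap by metis
    then show "\<exists>!g. g \<in> Hom (op_cat ?U) y x \<and> R f g"
      unfolding op_cat_simps fs.Hom_underlying_cat f R_def using x y by auto
  next
    fix y x g
    assume "g \<in> Hom (op_cat ?U) y x"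
    then obtain h where x: "x \<in> Hom C one X" and y: "y \<in> Hom C one X"
      and h: "h \<in> slice_hom C (right_fac F x) (right_fac F y)"
      and g: "g = (x, (right_fac F x, h, right_fac F y), y)"
      unfolding op_cat_simps fs.Hom_underlying_cat by blast
    show "\<exists>!f. f \<in> Hom ?U' y x \<and> R f g"
      unfolding fs'.Hom_underlying_cat g R_def using ex1_dual_maps[OF x y h] x y by auto
  next
    fix x
    assume "x \<in> Obj ?U'"
    then show "R (Ident ?U' x) (Ident (op_cat ?U) x)"
      unfolding underlying_cat_simps op_cat_simps R_def using dual_maps_ident by simp
  next
    fix z y x f f' g g'
    assume "f \<in> Hom ?U' z y" "f' \<in> Hom ?U' y x" "g \<in> Hom (op_cat ?U) z y"
      "g' \<in> Hom (op_cat ?U) y x" "R f g" "R f' g'"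
    then show "R (Comp ?U' f' f) (Comp (op_cat ?U) g' g)"
      unfolding op_cat_simps fs.Hom_underlying_cat fs'.Hom_underlying_cat
      by (auto simp: R_def underlying_cat_simps intro: dual_maps_comp)
  qed
qed

end
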